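(* Let $S=\langle L,\leq,\top,\bot,\Box,\boxtimes\rangle$ be any abstract provability structure. For every natural number $k$: (1) $\mathsf{E}_S(\boxtimes\Box^k)$ holds if and only if $\boxtimes\Box^k\boxtimes\top=\boxtimes\top$. (2) $\mathsf{E}_S(\boxtimes\Box^k)$ holds if and only if $\mathsf{U}_S(\boxtimes\Box^k\boxtimes\Box^k)$ holds. (3) If $\mathsf{E}_S(\boxtimes\Box^k)$ holds, then $\mathsf{E}_S(\boxtimes\Box^{k+1})$ holds.
   Context: An abstract provability structure (APS) is a tuple $S=\langle L,\leq,\top,\bot,\Box,\boxtimes\rangle$ where $L$ is a nonempty set, $\leq$ is a partial order on $L$, $\top,\bot\in L$, and $\Box,\boxtimes$ are unary operations on $L$ such that for all $x,y\in L$: (C1) if $x\leq y$ then $\Box x\leq\Box y$ and $\boxtimes y\leq\boxtimes x$; (C2) $\top\leq\boxtimes\bot$; (C3) if $x\leq\Box y$ and $x\leq\boxtimes y$ then $x\leq\boxtimes\top$; (C4) $\boxtimes x\leq\Box\boxtimes x$; (C5) $x\leq\top$. (It is not assumed that $\bot$ is the least element.) A one-variable APS term $\triangle v$ is generated from the variable $v$ by finitely many applications of $\Box$ and $\boxtimes$; it induces a unary operation $x\mapsto\triangle x$ on $L$. Compositions are written by concatenation, and $\Box^n$ is the $n$-fold iterate of $\Box$. Natural numbers include $0$. A fixed point of $\triangle v$ in $S$ is an element $p\in L$ with $\triangle p=p$. $\mathsf{E}_S(\triangle)$ means "$\triangle v$ has a fixed point in $S$"; $\mathsf{U}_S(\triangle)$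 means "$\triangle v$ has at most one fixed point in $S$". *)

theory Defs
  imports Main
begin

record 'a aps =
  carr :: "'a set"
  le_rel :: "'a rel"
  Top :: 'a
  Bot :: 'a
  box :: "'a \<Rightarrow> 'a"
  boxtimes :: "'a \<Rightarrow> 'a"

text \<open>
  \<^term>\<open>Bot S\<close> need not be the least element. The operations are only constrained on the
  carrier, and the order relation is contained in the product of the carrier with itself.
\<close>

locale abstract_provability_structure =
  fixes S :: "'a aps"
  assumes carr_nonempty: "carr S \<noteq> {}"
    and partial_order: "partial_order_on (carr S) (le_rel S)"
    and Top_in: "Top S \<in> carr S"
    and Bot_in: "Bot S \<in> carr S"
    and box_closed: "\<And>x. x \<in> carr S \<Longrightarrow> box S x \<in> carr S"
    and boxtimes_closed: "\<And>x. x \<in> carr S \<Longrightarrow> boxtimes S x \<in> carr S"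
    and C1_box: "\<And>x y. \<lbrakk>x \<in> carr S; y \<in> carr S; (x, y) \<in> le_rel S\<rbrakk>
                   \<Longrightarrow> (box S x, box S y) \<in> le_rel S"
    and C1_boxtimes: "\<And>x y. \<lbrakk>x \<in> carr S; y \<in> carr S; (x, y) \<in> le_rel S\<rbrakk>
                   \<Longrightarrow> (boxtimes S y, boxtimes S x) \<in> le_rel S"
    and C2: "(Top S, boxtimes S (Bot S)) \<in> le_rel S"
    and C3: "\<And>x y. \<lbrakk>x \<in> carr S; y \<in> carr S; (x, box S y) \<in> le_rel S;
                      (x, boxtimes S y) \<in> le_rel S\<rbrakk>
                   \<Longrightarrow> (x, boxtimes S (Top S)) \<in> le_rel S"
    and C4: "\<And>x. x \<in> carr S \<Longrightarrow> (boxtimes S x, box S (boxtimes S x)) \<in> le_rel S"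
    and C5: "\<And>x. x \<in> carr S \<Longrightarrow> (x, Top S) \<in> le_rel S"

datatype aps_term = V | Box aps_term | Boxtimes aps_term

primrec term_op :: "'a aps \<Rightarrow> aps_term \<Rightarrow> 'a \<Rightarrow> 'a" where
  "term_op S V x = x"
| "term_op S (Box t) x = box S (term_op S t x)"
| "term_op S (Boxtimes t) x = boxtimes S (term_op S t x)"

definition fixed_point :: "'a aps \<Rightarrow> aps_term \<Rightarrow> 'a \<Rightarrow> bool" where
  "fixed_point S t p \<longleftrightarrow> p \<in> carr S \<and> term_op S t p = p"

definition has_fixed_point :: "'a aps \<Rightarrow> aps_term \<Rightarrow> bool" where
  "has_fixed_point S t \<longleftrightarrow> (\<exists>p. fixed_point S t p)"

definition at_most_one_fixed_point :: "'a aps \<Rightarrow> aps_term \<Rightarrow> bool" where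
  "at_most_one_fixed_point S t \<longleftrightarrow> (\<forall>p q. fixed_point S t p \<longrightarrow> fixed_point S t q \<longrightarrow> p = q)"

end

theory Submission
  imports Defs
begin

(* Write N for boxtimes, a = N Top and T x = N (box^k x). Every value of N lies above a, and by C4
   every value z of N satisfies z \<le> box^(k+1) z. Hence if z is a value of N with T z \<le> z, then C3
   for x = T z and y = box^k z gives T z = a. Taking z = p, a fixed point p of T must be a. Taking
   z = T a, where T (T a) \<le> T a since a \<le> T a, we always get T (T a) = a; so a and T a are both
   fixed points of T^2, and uniqueness for T^2 forces T a = a. *)

lemma term_op_Box_funpow [simp]: "term_op S ((Box ^^ n) t) x = (box S ^^ n) (term_op S t x)"
  by (induction n) auto

context abstract_provability_structure
begin

abbreviation le (infix "\<sqsubseteq>" 50) where "x \<sqsubseteq> y \<equiv> (x, y) \<in> le_rel S"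

abbreviation NT where "NT \<equiv> boxtimes S (Top S)"

lemma le_refl: "x \<in> carr S \<Longrightarrow> x \<sqsubseteq> x"
  using partial_order by (auto simp: partial_order_on_def preorder_on_def refl_on_def)

lemma le_trans: "x \<sqsubseteq> y \<Longrightarrow> y \<sqsubseteq> z \<Longrightarrow> x \<sqsubseteq> z"
  using partial_order by (meson partial_order_on_def preorder_on_def transE)

lemma le_antisym: "x \<sqsubseteq> y \<Longrightarrow> y \<sqsubseteq> x \<Longrightarrow> x = y"
  using partial_order by (meson partial_order_on_def antisymD)

lemma box_funpow_closed: "x \<in> carr S \<Longrightarrow> (box S ^^ n) x \<in> carr S"
  by (induction n) (auto simp: box_closed)

lemma box_funpow_mono:
  "x \<in> carr S \<Longrightarrow> y \<in> carr S \<Longrightarrow> x \<sqsubseteq> y \<Longrightarrow> (box S ^^ n) x \<sqsubseteq> (box S ^^ n) y"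
  by (induction n) (auto simp: C1_box box_funpow_closed)

lemma NT_closed: "NT \<in> carr S"
  by (simp add: boxtimes_closed Top_in)

lemma NT_le_boxtimes: "x \<in> carr S \<Longrightarrow> NT \<sqsubseteq> boxtimes S x"
  by (simp add: C1_boxtimes C5 Top_in)

text \<open>C4 supplies one box in front of a value of \<open>boxtimes\<close>. Monotonicity of
  \<open>box\<close> lifts the bound for \<open>n\<close> boxes under one more, and transitivity
  joins the two.\<close>

lemma boxtimes_le_box_funpow:
  assumes "x \<in> carr S"
  shows "boxtimes S x \<sqsubseteq> (box S ^^ n) (boxtimes S x)"
proof (induction n)
  case 0
  then show ?case using assms by (simp add: le_refl boxtimes_closed)
next
  case (Suc n)
  then have "box S (boxtimes S x) \<sqsubseteq> (box S ^^ Suc n) (boxtimes S x)"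
    using assms by (simp add: C1_box boxtimes_closed box_funpow_closed)
  then show ?case using C4 assms le_trans by blast
qed

lemma boxtimes_box_funpow_closed: "x \<in> carr S \<Longrightarrow> boxtimes S ((box S ^^ k) x) \<in> carr S"
  by (simp add: boxtimes_closed box_funpow_closed)

lemma boxtimes_box_funpow_antimono:
  "x \<in> carr S \<Longrightarrow> y \<in> carr S \<Longrightarrow> x \<sqsubseteq> y
    \<Longrightarrow> boxtimes S ((box S ^^ k) y) \<sqsubseteq> boxtimes S ((box S ^^ k) x)"
  by (simp add: C1_boxtimes box_funpow_closed box_funpow_mono)

lemma boxtimes_box_funpow_eq_NT:
  assumes w: "w \<in> carr S"
    and le: "boxtimes S ((box S ^^ k) (boxtimes S w)) \<sqsubseteq> boxtimes S w"
  shows "boxtimes S ((box S ^^ k) (boxtimes S w)) = NT"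
proof (rule le_antisym)
  let ?y = "(box S ^^ k) (boxtimes S w)"
  have y: "?y \<in> carr S" using w by (simp add: boxtimes_closed box_funpow_closed)
  \<comment> \<open>The exponent is \<open>Suc k\<close> rather than \<open>k\<close> because
    \<open>?y\<close> already absorbs \<open>k\<close> boxes; the one left over is the box that C3
    asks for. The other premise of C3 is reflexivity.\<close>
  have "boxtimes S ?y \<sqsubseteq> box S ?y"
    using le_trans[OF le boxtimes_le_box_funpow[OF w, of "Suc k"]] by simp
  then show "boxtimes S ?y \<sqsubseteq> NT"
    using y by (meson C3 boxtimes_closed le_refl)
  show "NT \<sqsubseteq> boxtimes S ?y" using y by (rule NT_le_boxtimes)
qed

text \<open>A fixed point is itself a value of \<open>boxtimes\<close>, taken at
  \<open>(box S ^^ k) p\<close>, so the inequality required by the previous lemma is just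
  reflexivity.\<close>

lemma fixed_point_eq_NT:
  assumes "p \<in> carr S" "boxtimes S ((box S ^^ k) p) = p"
  shows "p = NT"
  using boxtimes_box_funpow_eq_NT[of "(box S ^^ k) p" k] assms
  by (simp add: box_funpow_closed le_refl)

lemma double_boxtimes_box_funpow_NT:
  "boxtimes S ((box S ^^ k) (boxtimes S ((box S ^^ k) NT))) = NT"
proof (rule boxtimes_box_funpow_eq_NT)
  show "(box S ^^ k) NT \<in> carr S" by (simp add: box_funpow_closed NT_closed)
  then show "boxtimes S ((box S ^^ k) (boxtimes S ((box S ^^ k) NT)))
      \<sqsubseteq> boxtimes S ((box S ^^ k) NT)"
    by (simp add: boxtimes_box_funpow_antimono boxtimes_closed NT_closed NT_le_boxtimes)
qed

lemma has_fixed_point_iff: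
  "has_fixed_point S (Boxtimes ((Box ^^ k) V)) \<longleftrightarrow> boxtimes S ((box S ^^ k) NT) = NT"
  unfolding has_fixed_point_def fixed_point_def term_op.simps term_op_Box_funpow
  by (metis fixed_point_eq_NT NT_closed)

text \<open>The right-hand side is the criterion already found for existence, so the equivalence of
  existence and uniqueness needs no direct argument.\<close>

lemma at_most_one_fixed_point_iff:
  "at_most_one_fixed_point S (Boxtimes ((Box ^^ k) (Boxtimes ((Box ^^ k) V))))
    \<longleftrightarrow> boxtimes S ((box S ^^ k) NT) = NT"
proof
  assume "at_most_one_fixed_point S (Boxtimes ((Box ^^ k) (Boxtimes ((Box ^^ k) V))))"
  then show "boxtimes S ((box S ^^ k) NT) = NT"
    unfolding at_most_one_fixed_point_def fixed_point_def term_op.simps term_op_Box_funpow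
    by (metis NT_closed boxtimes_box_funpow_closed double_boxtimes_box_funpow_NT)
next
  assume fix_NT: "boxtimes S ((box S ^^ k) NT) = NT"
  have "p = NT"
    if p: "p \<in> carr S" and fix_p: "boxtimes S ((box S ^^ k) (boxtimes S ((box S ^^ k) p))) = p" for p
  proof -
    \<comment> \<open>With T as above, p = T (T p) is a value of \<open>boxtimes\<close>, hence
      above \<open>NT\<close>. Antitonicity puts T p below T \<open>NT\<close> = \<open>NT\<close>,
      so T p = \<open>NT\<close>, and applying T once more gives p = T \<open>NT\<close> =
      \<open>NT\<close>.\<close>
    have "NT \<sqsubseteq> p"
      using NT_le_boxtimes[of "(box S ^^ k) (boxtimes S ((box S ^^ k) p))"] p fix_p
      by (simp add: box_funpow_closed boxtimes_closed)
    then have "boxtimes S ((box S ^^ k) p) \<sqsubseteq> NT"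
      using boxtimes_box_funpow_antimono[OF NT_closed p] fix_NT by metis
    then have "boxtimes S ((box S ^^ k) p) = NT"
      by (rule le_antisym) (intro NT_le_boxtimes box_funpow_closed p)
    then show ?thesis using fix_p fix_NT by simp
  qed
  then show "at_most_one_fixed_point S (Boxtimes ((Box ^^ k) (Boxtimes ((Box ^^ k) V))))"
    unfolding at_most_one_fixed_point_def fixed_point_def term_op.simps term_op_Box_funpow
    by metis
qed

text \<open>C4 at \<open>Top S\<close> says that \<open>NT\<close> lies below
  \<open>box S NT\<close>. The antitone operation for \<open>k\<close> reverses this, so the extra
  box can only lower the value, which was already the least value of
  \<open>boxtimes\<close>.\<close>

lemma fixed_NT_Suc:
  assumes "boxtimes S ((box S ^^ k) NT) = NT"
  shows "boxtimes S ((box S ^^ Suc k) NT) = NT"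
proof (rule le_antisym)
  have "boxtimes S ((box S ^^ k) (box S NT)) \<sqsubseteq> boxtimes S ((box S ^^ k) NT)"
    by (intro boxtimes_box_funpow_antimono NT_closed box_closed C4 Top_in)
  then show "boxtimes S ((box S ^^ Suc k) NT) \<sqsubseteq> NT"
    \<comment> \<open>The additional box is innermost in the inequality above but outermost in the
      unfolded \<open>Suc k\<close>-fold iterate; \<open>funpow_swap1\<close> reconciles the
      two.\<close>
    using assms by (simp add: funpow_swap1)
  show "NT \<sqsubseteq> boxtimes S ((box S ^^ Suc k) NT)"
    by (intro NT_le_boxtimes box_funpow_closed NT_closed)
qed

end

theorem proposition5p1:
  fixes S :: "'a aps" and k :: nat
  assumes "abstract_provability_structure S"
  shows "(has_fixed_point S (Boxtimes ((Box ^^ k) V)) \<longleftrightarrow>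
            boxtimes S ((box S ^^ k) (boxtimes S (Top S))) = boxtimes S (Top S)) \<and>
         (has_fixed_point S (Boxtimes ((Box ^^ k) V)) \<longleftrightarrow>
            at_most_one_fixed_point S (Boxtimes ((Box ^^ k) (Boxtimes ((Box ^^ k) V))))) \<and>
         (has_fixed_point S (Boxtimes ((Box ^^ k) V)) \<longrightarrow>
            has_fixed_point S (Boxtimes ((Box ^^ (k + 1)) V)))"
proof -
  interpret abstract_provability_structure S by fact
  show ?thesis
    using has_fixed_point_iff[of k] at_most_one_fixed_point_iff[of k]
      has_fixed_point_iff[of "Suc k"] fixed_NT_Suc[of k]
    unfolding Suc_eq_plus1 by blast
qed

end
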